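(* Let $n$ be a positive integer and let $k$ be a real number with $2 \le k \le \frac{1}{648}\log\log n$. Let $G$ be an $n$-vertex graph satisfying: (i) $G$ has average degree at least $k$ and maximum degree at most $6k$; (ii) $G$ has girth at least $\log n/(6k)^2$; (iii) every $t$-vertex subgraph $H$ of $G$ with $t\ge \log n/(6k)^2$ satisfies $\mathrm{sep}_V(H) \le \mathrm{sep}_E(H)\le \frac{t}{\log t}(\log\log t)^2$. Then any subgraph of $G$ with average degree at least $4$ has a connected component with edge expansion at most $$\frac{1}{\log n}\,(15k\log\log n)^2 .$$
   Context: Graphs are finite, simple and undirected; subgraphs are not necessarily induced; $\log$ denotes $\log_2$. The girth of a graph is the minimum length of a cycle in it. An edge separator in a graph $G=(V,E)$ is a set $F\subseteq E$ for which there is a partition $V=A\cup B$ with $|A|,|B|\le\frac23|V|$ and no edge of $E\setminus F$ between $A$ and $B$; $\mathrm{sep}_E(G)$ is the minimum cardinality of an edge separator. A vertex separator is a set $S\subseteq V$ such that $V\setminus S$ can be partitioned into two sets $A,B$ with $|A|,|B|\le\frac23|V|$ and no edge of $G$ between $A$ and $B$; $\mathrm{sep}_V(G)$ is the minimum cardinality of a vertex separator. A graph $H=(V,E)$ is said to have edge expansion $\alpha$ if every $S\subseteq V$ with $|S|\le |V|/2$ satisfies $|\partial(S)|\ge\alpha|S|$, where $\partial(S)$ is the set of edges with precisely one endpoint in $S$. Accordingly, $H$ has edge expansion at most $\beta$ if there is a nonempty $S\subseteq V$ with $|S|\le|V|/2$ and $|\partial(S)|\le\beta|S|$. *)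

theory Defs
  imports Complex_Main "HOL-Library.Extended_Real"
begin

datatype 'a ugraph = UGraph (verts: "'a set") (edges: "'a set set")

definition simple_graph :: "'a ugraph \<Rightarrow> bool" where
  "simple_graph G \<longleftrightarrow> finite (verts G) \<and> (\<forall>e\<in>edges G. e \<subseteq> verts G \<and> card e = 2)"

definition subgraph :: "'a ugraph \<Rightarrow> 'a ugraph \<Rightarrow> bool" where
  "subgraph H G \<longleftrightarrow> simple_graph H \<and> verts H \<subseteq> verts G \<and> edges H \<subseteq> edges G"

definition degree :: "'a ugraph \<Rightarrow> 'a \<Rightarrow> nat" where
  "degree G v = card {e \<in> edges G. v \<in> e}"

text \<open>For the graph without vertices the average degree is \<open>0 / 0 = 0\<close>.\<close>

definition average_degree :: "'a ugraph \<Rightarrow> real" where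
  "average_degree G = (\<Sum>v\<in>verts G. real (degree G v)) / real (card (verts G))"

definition max_degree :: "'a ugraph \<Rightarrow> nat" where
  "max_degree G = Max (degree G ` verts G)"

text \<open>A cycle is given by the list of its vertices in cyclic order, without repeating
  the first vertex at the end, so that its number of edges is the length of the list.\<close>

definition is_cycle :: "'a ugraph \<Rightarrow> 'a list \<Rightarrow> bool" where
  "is_cycle G c \<longleftrightarrow> length c \<ge> 3 \<and> distinct c \<and>
     (\<forall>i<length c. {c ! i, c ! (Suc i mod length c)} \<in> edges G)"

text \<open>The girth of an acyclic graph is \<open>\<infinity>\<close>.\<close>

definition girth :: "'a ugraph \<Rightarrow> enat" where
  "girth G = Inf {enat (length c) | c. is_cycle G c}"

text \<open>In both notions of separator a part may be empty if the size bounds permit it.\<close>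

definition edge_separator :: "'a ugraph \<Rightarrow> 'a set set \<Rightarrow> bool" where
  "edge_separator G F \<longleftrightarrow> F \<subseteq> edges G \<and>
     (\<exists>A B. verts G = A \<union> B \<and> A \<inter> B = {} \<and>
        real (card A) \<le> 2/3 * real (card (verts G)) \<and>
        real (card B) \<le> 2/3 * real (card (verts G)) \<and>
        (\<forall>a\<in>A. \<forall>b\<in>B. {a, b} \<notin> edges G - F))"

definition vertex_separator :: "'a ugraph \<Rightarrow> 'a set \<Rightarrow> bool" where
  "vertex_separator G S \<longleftrightarrow> S \<subseteq> verts G \<and>
     (\<exists>A B. verts G - S = A \<union> B \<and> A \<inter> B = {} \<and>
        real (card A) \<le> 2/3 * real (card (verts G)) \<and>
        real (card B) \<le> 2/3 * real (card (verts G)) \<and>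
        (\<forall>a\<in>A. \<forall>b\<in>B. {a, b} \<notin> edges G))"

text \<open>Every simple graph has a vertex separator (the whole vertex set), and every simple graph
  whose number of vertices is not \<open>1\<close> has an edge separator, so that the minimum exists.
  For a graph with a single vertex the value of \<open>sep_E\<close> is meaningless.\<close>

definition sep_E :: "'a ugraph \<Rightarrow> nat" where
  "sep_E G = (LEAST m. \<exists>F. edge_separator G F \<and> card F = m)"

definition sep_V :: "'a ugraph \<Rightarrow> nat" where
  "sep_V G = (LEAST m. \<exists>S. vertex_separator G S \<and> card S = m)"

definition connected_graph :: "'a ugraph \<Rightarrow> bool" where
  "connected_graph G \<longleftrightarrow> verts G \<noteq> {} \<and>
     (\<forall>u\<in>verts G. \<forall>v\<in>verts G. (u, v) \<in> {(x, y). {x, y} \<in> edges G}\<^sup>*)"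

definition connected_component :: "'a ugraph \<Rightarrow> 'a ugraph \<Rightarrow> bool" where
  "connected_component C G \<longleftrightarrow> subgraph C G \<and> connected_graph C \<and>
     (\<forall>D. subgraph D G \<and> connected_graph D \<and> subgraph C D \<longrightarrow> D = C)"

definition edge_boundary :: "'a ugraph \<Rightarrow> 'a set \<Rightarrow> 'a set set" where
  "edge_boundary G S = {e \<in> edges G. card (e \<inter> S) = 1}"

definition edge_expansion_at_most :: "'a ugraph \<Rightarrow> real \<Rightarrow> bool" where
  "edge_expansion_at_most G \<beta> \<longleftrightarrow>
     (\<exists>S. S \<subseteq> verts G \<and> S \<noteq> {} \<and> real (card S) \<le> real (card (verts G)) / 2 \<and>
        real (card (edge_boundary G S)) \<le> \<beta> * real (card S))"

end

theory Submission imports Defs begin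

text \<open>A subgraph \<open>H\<close> with average degree at least \<open>4\<close> contains a nonempty vertex set inducing
  minimum degree at least \<open>3\<close>. Fix a vertex \<open>v\<close> of this set. There are at least \<open>2 ^ r\<close>
  non-backtracking walks of length \<open>r\<close> from \<open>v\<close> inside it, and if \<open>2 r\<close> is smaller than the girth
  then no two of them share their endpoint. So the component of \<open>v\<close> in \<open>H\<close> has \<open>t\<close> vertices with
  \<open>log t\<close> at least roughly half of the girth, and a balanced edge separator of that component
  provided by (iii) splits off a set of at least \<open>t / 3\<close> vertices with small edge boundary.\<close>

section \<open>Basic facts on simple graphs\<close>

lemma simple_graph_finite_edges:
  assumes "simple_graph G"
  shows "finite (edges G)"
  using assms unfolding simple_graph_def
  by (meson Pow_iff finite_Pow_iff finite_subset subsetI)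

lemma subgraph_trans: "subgraph A B \<Longrightarrow> subgraph B C \<Longrightarrow> subgraph A C"
  unfolding subgraph_def by blast

lemma simple_graph_edge_neq: "simple_graph G \<Longrightarrow> {x, y} \<in> edges G \<Longrightarrow> x \<noteq> y"
  unfolding simple_graph_def by force

text \<open>Handshake lemma: incident pairs of a vertex and an edge are counted in two ways.\<close>

lemma sum_degree:
  assumes "simple_graph G"
  shows "(\<Sum>v\<in>verts G. degree G v) = 2 * card (edges G)"
proof -
  have fin: "finite (verts G)" "finite (edges G)"
    using assms simple_graph_finite_edges by (auto simp: simple_graph_def)
  have "(\<Sum>v\<in>verts G. degree G v) = (\<Sum>v\<in>verts G. \<Sum>e\<in>edges G. if v \<in> e then 1 else 0)"
    using fin by (simp add: degree_def sum.If_cases Int_def)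
  also have "\<dots> = (\<Sum>e\<in>edges G. \<Sum>v\<in>verts G. if v \<in> e then 1 else 0)"
    by (rule sum.swap)
  also have "\<dots> = (\<Sum>e\<in>edges G. card (verts G \<inter> e))"
    using fin by (simp add: sum.If_cases Int_def)
  also have "\<dots> = (\<Sum>e\<in>edges G. 2)"
    using assms by (intro sum.cong) (auto simp: simple_graph_def Int_absorb1)
  finally show ?thesis by simp
qed

section \<open>Passing to minimum degree at least 3\<close>

definition induced_subgraph :: "'a ugraph \<Rightarrow> 'a set \<Rightarrow> 'a ugraph" where
  "induced_subgraph G W = UGraph W {e \<in> edges G. e \<subseteq> W}"

lemma induced_subgraph_sel [simp]:
  "verts (induced_subgraph G W) = W" "edges (induced_subgraph G W) = {e \<in> edges G. e \<subseteq> W}"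
  by (simp_all add: induced_subgraph_def)

lemma subgraph_induced_subgraph:
  assumes "simple_graph G" "W \<subseteq> verts G"
  shows "subgraph (induced_subgraph G W) G"
  using assms finite_subset by (auto simp: subgraph_def simple_graph_def)

text \<open>A smallest nonempty \<open>W\<close> spanning at least \<open>2 * card W\<close> edges
  works: deleting a vertex of degree at most 2 loses at most two edges and so preserves the
  inequality, against minimality. The deletion leaves a nonempty set because a single vertex spans
  no edge.\<close>

lemma min_degree_3_subgraph:
  assumes G: "simple_graph G" and avg: "average_degree G \<ge> 4"
  obtains W where "W \<subseteq> verts G" "W \<noteq> {}" "\<And>v. v \<in> W \<Longrightarrow> degree (induced_subgraph G W) v \<ge> 3"
proof -
  have fin: "finite (verts G)" "finite (edges G)"
    using assms simple_graph_finite_edges by (auto simp: simple_graph_def)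
  define P where "P W \<longleftrightarrow> W \<subseteq> verts G \<and> W \<noteq> {} \<and> 2 * card W \<le> card {e \<in> edges G. e \<subseteq> W}" for W
  have ne: "verts G \<noteq> {}"
    using avg by (auto simp: average_degree_def)
  have "(\<Sum>v\<in>verts G. real (degree G v)) = 2 * real (card (edges G))"
    using arg_cong[OF sum_degree[OF G], of real] by simp
  hence "4 \<le> 2 * real (card (edges G)) / real (card (verts G))"
    using avg by (simp add: average_degree_def)
  hence "2 * card (verts G) \<le> card (edges G)"
    using ne fin by (simp add: pos_le_divide_eq card_gt_0_iff)
  moreover have "{e \<in> edges G. e \<subseteq> verts G} = edges G"
    using G by (auto simp: simple_graph_def)
  ultimately have "P (verts G)"
    using ne by (simp add: P_def)
  then obtain W where W: "P W" and least: "\<And>U. P U \<Longrightarrow> card W \<le> card U"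
    using ex_has_least_nat[of P _ card] by blast
  have "degree (induced_subgraph G W) v \<ge> 3" if v: "v \<in> W" for v
  proof (rule ccontr)
    assume small: "\<not> ?thesis"
    let ?E = "{e \<in> edges G. e \<subseteq> W}" and ?E' = "{e \<in> edges G. e \<subseteq> W - {v}}"
    let ?D = "{e \<in> ?E. v \<in> e}"
    have fW: "finite W" using W fin finite_subset by (auto simp: P_def)
    have D: "card ?D \<le> 2" using small by (simp add: degree_def)
    have "?E = ?E' \<union> ?D" by auto
    hence "card ?E \<le> card ?E' + card ?D" by (metis (lifting) card_Un_le)
    moreover have "2 * card W \<le> card ?E" using W by (simp add: P_def)
    moreover have cW: "card W = Suc (card (W - {v}))" using v fW by (metis card_Suc_Diff1)
    ultimately have le: "2 * card (W - {v}) \<le> card ?E'" using D by linarith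
    have "W - {v} \<noteq> {}"
    proof
      assume "W - {v} = {}"
      hence "W = {v}" using v by blast
      hence "?E = {}" using G by (force simp: simple_graph_def subset_singleton_iff)
      hence "card ?E = 0" by (simp only: card.empty)
      moreover have "card W > 0" using W fW by (simp add: P_def card_gt_0_iff)
      ultimately show False using W unfolding P_def by linarith
    qed
    hence "P (W - {v})" using W le by (auto simp: P_def)
    thus False using least cW by force
  qed
  thus ?thesis using that W by (auto simp: P_def)
qed

section \<open>Non-backtracking walks and cycles\<close>

lemma closed_nonbacktracking_walk_cycle:
  assumes G: "simple_graph G"
    and adj: "\<And>i. i < m \<Longrightarrow> {f i, f (Suc i)} \<in> edges G"
    and nb: "\<And>i. Suc (Suc i) \<le> m \<Longrightarrow> f i \<noteq> f (Suc (Suc i))"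
    and closed: "f 0 = f m" "0 < m"
  shows "\<exists>c. is_cycle G c \<and> length c \<le> m"
proof -
  \<comment> \<open>Take a repetition \<open>f i = f j\<close> with the smallest gap
    \<open>j - i\<close>. By minimality the vertices from \<open>i\<close> to \<open>j - 1\<close>
    are distinct; gap 1 would be a loop and gap 2 a backtrack, so the segment is a cycle.\<close>
  define P where "P = (\<lambda>(i, j). i < j \<and> j \<le> m \<and> f i = f j)"
  have "P (0, m)" using closed by (simp add: P_def)
  then obtain p where p: "P p" and least: "\<And>q. P q \<Longrightarrow> snd p - fst p \<le> snd q - fst q"
    using ex_has_least_nat[of P _ "\<lambda>p. snd p - fst p"] by blast
  obtain i j where pij: "p = (i, j)" by force
  have ij: "i < j" "j \<le> m" "f i = f j" using p by (auto simp: P_def pij)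
  have min: "j - i \<le> j' - i'" if "i' < j'" "j' \<le> m" "f i' = f j'" for i' j'
    using least[of "(i', j')"] that by (simp add: P_def pij)
  have inj: "inj_on f {i..<j}"
  proof (rule linorder_inj_onI)
    fix x y assume "x < y" "x \<in> {i..<j}" "y \<in> {i..<j}"
    thus "f x \<noteq> f y" using min[of x y] ij by auto
  qed auto
  have "j \<noteq> Suc i" using simple_graph_edge_neq[OF G adj[of i]] ij by auto
  moreover have "j \<noteq> Suc (Suc i)" using nb[of i] ij by auto
  ultimately have len: "j - i \<ge> 3" using ij by linarith
  have "is_cycle G (map f [i..<j])"
    unfolding is_cycle_def
  proof (intro conjI allI impI)
    show "distinct (map f [i..<j])" using inj by (simp add: distinct_map)
    show "length (map f [i..<j]) \<ge> 3" using len by simp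
    fix x assume "x < length (map f [i..<j])"
    hence x: "x < j - i" by simp
    have e: "{f (i + x), f (Suc (i + x))} \<in> edges G" using adj[of "i + x"] x ij by simp
    show "{map f [i..<j] ! x, map f [i..<j] ! (Suc x mod length (map f [i..<j]))} \<in> edges G"
    proof (cases "Suc x = j - i")
      \<comment> \<open>The successor index wraps around to 0 here, and the closing edge is the last
        edge of the segment because \<open>f j = f i\<close>.\<close>
      case True
      hence "Suc (i + x) = j" by simp
      thus ?thesis using True x e ij by simp
    next
      case False
      thus ?thesis using x e by simp
    qed
  qed
  thus ?thesis using ij by (intro exI[of _ "map f [i..<j]"]) auto
qed

text \<open>A walk with \<open>r\<close> edges is stored with its newest vertex first, so
  \<open>hd xs\<close> is the endpoint, the start \<open>v\<close> comes last and
  \<open>xs ! 1\<close> is the vertex visited just before the endpoint. For \<open>r = 0\<close>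
  there is no such vertex, hence the guard.\<close>

fun nb_walks :: "'a ugraph \<Rightarrow> 'a \<Rightarrow> nat \<Rightarrow> 'a list set" where
  "nb_walks G v 0 = {[v]}"
| "nb_walks G v (Suc r) =
    {x # xs | x xs. xs \<in> nb_walks G v r \<and> {x, hd xs} \<in> edges G \<and> (0 < r \<longrightarrow> x \<noteq> xs ! 1)}"

lemma nb_walks_props:
  assumes "xs \<in> nb_walks G v r"
  shows "length xs = Suc r \<and> xs ! r = v \<and> (\<forall>i<r. {xs ! i, xs ! Suc i} \<in> edges G) \<and>
    (\<forall>i. Suc (Suc i) \<le> r \<longrightarrow> xs ! i \<noteq> xs ! Suc (Suc i))"
  using assms
proof (induction r arbitrary: xs)
  case 0
  thus ?case by simp
next
  case (Suc r)
  then obtain x ys where xs: "xs = x # ys" "ys \<in> nb_walks G v r" "{x, hd ys} \<in> edges G"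
    "0 < r \<longrightarrow> x \<noteq> ys ! 1" by auto
  note IH = Suc.IH[OF xs(2)]
  have "hd ys = ys ! 0" using IH by (intro hd_conv_nth) auto
  thus ?case using IH xs by (auto simp: nth_Cons split: nat.splits)
qed

lemma finite_nb_walks:
  assumes "simple_graph G"
  shows "finite (nb_walks G v r)"
proof (induction r)
  case (Suc r)
  have "nb_walks G v (Suc r) \<subseteq> (\<lambda>(x, xs). x # xs) ` (verts G \<times> nb_walks G v r)"
    using assms by (force simp: simple_graph_def)
  thus ?case using Suc assms finite_subset by (fastforce simp: simple_graph_def)
qed simp

text \<open>The endpoint of a walk has at least three neighbours and at most one of them, the
  previous vertex, is forbidden as the next one. So every walk has at least two extensions, given by
  \<open>X xs\<close>.\<close>

lemma card_nb_walks:
  assumes G: "simple_graph G" and v: "v \<in> verts G"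
    and deg: "\<And>u. u \<in> verts G \<Longrightarrow> degree G u \<ge> 3"
  shows "2 ^ r \<le> card (nb_walks G v r)"
proof (induction r)
  case (Suc r)
  have finV: "finite (verts G)" using G by (simp add: simple_graph_def)
  define X where "X xs = {x. {x, hd xs} \<in> edges G \<and> (0 < r \<longrightarrow> x \<noteq> xs ! 1)}" for xs
  have XV: "X xs \<subseteq> verts G" for xs
    using G by (auto simp: X_def simple_graph_def)
  have finX: "finite (X xs)" for xs
    using XV finV by (rule finite_subset)
  have "nb_walks G v (Suc r) = (\<lambda>(xs, x). x # xs) ` Sigma (nb_walks G v r) X"
    by (force simp: X_def)
  moreover have "inj_on (\<lambda>(xs, x). x # xs) (Sigma (nb_walks G v r) X)"
    by (auto simp: inj_on_def)
  ultimately have "card (nb_walks G v (Suc r)) = card (Sigma (nb_walks G v r) X)"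
    by (simp add: card_image)
  also have "\<dots> = (\<Sum>xs\<in>nb_walks G v r. card (X xs))"
    using finite_nb_walks[OF G] finX by (intro card_SigmaI) auto
  also have "\<dots> \<ge> (\<Sum>xs\<in>nb_walks G v r. 2)"
  proof (rule sum_mono)
    fix xs assume xs: "xs \<in> nb_walks G v r"
    note P = nb_walks_props[OF xs]
    have hd: "hd xs = xs ! 0" using P by (intro hd_conv_nth) auto
    have "hd xs \<in> verts G"
      using P G v hd by (cases r) (force simp: simple_graph_def)+
    hence deg3: "3 \<le> degree G (hd xs)" by (rule deg)
    have finN: "finite {x. {x, hd xs} \<in> edges G}"
      using G by (intro finite_subset[OF _ finV]) (auto simp: simple_graph_def)
    note deg3
    also have "degree G (hd xs) \<le> card ((\<lambda>x. {x, hd xs}) ` {x. {x, hd xs} \<in> edges G})"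
      unfolding degree_def
    proof (rule card_mono)
      show "finite ((\<lambda>x. {x, hd xs}) ` {x. {x, hd xs} \<in> edges G})"
        using finN by (rule finite_imageI)
      show "{e \<in> edges G. hd xs \<in> e} \<subseteq> (\<lambda>x. {x, hd xs}) ` {x. {x, hd xs} \<in> edges G}"
      proof
        fix e assume e: "e \<in> {e \<in> edges G. hd xs \<in> e}"
        hence "card e = 2" using G by (auto simp: simple_graph_def)
        then obtain x where "e = {x, hd xs}" using e by (auto simp: card_2_iff)
        thus "e \<in> (\<lambda>x. {x, hd xs}) ` {x. {x, hd xs} \<in> edges G}" using e by auto
      qed
    qed
    also have "\<dots> \<le> card {x. {x, hd xs} \<in> edges G}"
      using finN by (rule card_image_le)
    \<comment> \<open>Inserting \<open>xs ! 1\<close> treats both cases at once: for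
      \<open>r = 0\<close> the set \<open>X xs\<close> already contains all neighbours.\<close>
    also have "\<dots> \<le> card (insert (xs ! 1) (X xs))"
      using finX by (intro card_mono) (auto simp: X_def)
    also have "\<dots> \<le> Suc (card (X xs))" by (rule card_insert_le_m1) auto
    finally show "2 \<le> card (X xs)" by simp
  qed
  finally show ?case using Suc by simp
qed simp

text \<open>Take two walks with a common endpoint. If their previous vertices agree, the induction
  hypothesis applies to the shortened walks. Otherwise, going out along one and back along the other
  is a closed walk of length twice that of each walk that never backtracks, so it yields a cycle
  that is too short.\<close>

lemma inj_on_hd_nb_walks:
  assumes G: "simple_graph G" and no_cycle: "\<And>c. is_cycle G c \<Longrightarrow> 2 * r < length c"
  shows "inj_on hd (nb_walks G v r)"
  using no_cycle
proof (induction r)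
  case (Suc r)
  show ?case
  proof (rule inj_onI)
    fix xs ys assume xs: "xs \<in> nb_walks G v (Suc r)" and ys: "ys \<in> nb_walks G v (Suc r)"
      and hd: "hd xs = hd ys"
    obtain x xs' where xs': "xs = x # xs'" "xs' \<in> nb_walks G v r" using xs by auto
    obtain y ys' where ys': "ys = y # ys'" "ys' \<in> nb_walks G v r" using ys by auto
    note Px = nb_walks_props[OF xs] and Py = nb_walks_props[OF ys]
    have hd0: "xs ! 0 = ys ! 0" using hd xs' ys' by simp
    have "hd xs' = hd ys'"
    proof (rule ccontr)
      assume "hd xs' \<noteq> hd ys'"
      hence neq: "xs ! 1 \<noteq> ys ! 1"
        using xs' ys' nb_walks_props[OF xs'(2)] nb_walks_props[OF ys'(2)]
        by (metis One_nat_def Zero_not_Suc hd_conv_nth list.size(3) nth_Cons_Suc)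
      \<comment> \<open>\<open>f\<close> follows \<open>xs\<close> from \<open>v\<close> to the
        common endpoint, reached at \<open>i = Suc r\<close>, and then returns to \<open>v\<close>
        along \<open>ys\<close>. Since lists start at the endpoint, the outward half is read with
        reversed indices.\<close>
      define f where "f i = (if i \<le> Suc r then xs ! (Suc r - i) else ys ! (i - Suc r))" for i
      have "\<exists>c. is_cycle G c \<and> length c \<le> 2 * Suc r"
      proof (rule closed_nonbacktracking_walk_cycle[OF G, of _ f])
        show "f 0 = f (2 * Suc r)" using Px Py by (simp add: f_def)
        fix i
        show "{f i, f (Suc i)} \<in> edges G" if i: "i < 2 * Suc r"
        proof (cases "i < Suc r")
          case True
          hence "{xs ! (r - i), xs ! Suc (r - i)} \<in> edges G" using Px by auto
          moreover have "Suc r - i = Suc (r - i)" using True by simp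
          ultimately show ?thesis using True by (simp add: f_def insert_commute)
        next
          case False
          hence "{ys ! (i - Suc r), ys ! Suc (i - Suc r)} \<in> edges G" using Py i by auto
          moreover have "f i = ys ! (i - Suc r)"
            using False hd0 by (cases "i = Suc r") (auto simp: f_def)
          moreover have "Suc (i - Suc r) = i - r" using False by simp
          ultimately show ?thesis using False by (simp add: f_def)
        qed
        show "f i \<noteq> f (Suc (Suc i))" if i: "Suc (Suc i) \<le> 2 * Suc r"
        proof (cases "i < r")
          case True
          hence "xs ! (r - Suc i) \<noteq> xs ! Suc (Suc (r - Suc i))" using Px by auto
          moreover have "Suc r - i = Suc (Suc (r - Suc i))" using True by simp
          ultimately show ?thesis using True by (auto simp: f_def)
        next
          case ge: False
          show ?thesis
          proof (cases "i = r")
            \<comment> \<open>This is the turning point: the vertices on either side of the common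
              endpoint are \<open>xs ! 1\<close> and \<open>ys ! 1\<close>.\<close>
            case True
            thus ?thesis using neq by (simp add: f_def)
          next
            case False
            with ge have i': "Suc r \<le> i" by simp
            hence "ys ! (i - Suc r) \<noteq> ys ! Suc (Suc (i - Suc r))" using Py i by auto
            moreover have "f i = ys ! (i - Suc r)"
              using i' hd0 by (cases "i = Suc r") (auto simp: f_def)
            moreover have "Suc (Suc (i - Suc r)) = Suc i - r" using i' by simp
            ultimately show ?thesis using i' by (simp add: f_def)
          qed
        qed
      qed simp
      thus False using Suc.prems by force
    qed
    moreover have "inj_on hd (nb_walks G v r)" using Suc.prems by (intro Suc.IH) force
    ultimately have "xs' = ys'" using xs' ys' by (auto dest: inj_onD)
    thus "xs = ys" using hd xs' ys' by simp
  qed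
qed simp

section \<open>Connected components\<close>

definition component_of :: "'a ugraph \<Rightarrow> 'a \<Rightarrow> 'a ugraph" where
  "component_of G v = induced_subgraph G {u. (v, u) \<in> {(x, y). {x, y} \<in> edges G}\<^sup>*}"

lemma component_of_connected_component:
  assumes G: "simple_graph G" and v: "v \<in> verts G"
  shows "connected_component (component_of G v) G"
proof -
  let ?R = "{(x, y). {x, y} \<in> edges G}"
  let ?C = "component_of G v" and ?W = "{u. (v, u) \<in> ?R\<^sup>*}"
  let ?Q = "{(x, y). {x, y} \<in> edges ?C}"
  have WV: "?W \<subseteq> verts G"
  proof
    fix u assume "u \<in> ?W"
    hence "(v, u) \<in> ?R\<^sup>*" by simp
    thus "u \<in> verts G" using v G by induction (auto simp: simple_graph_def)
  qed
  have sub: "subgraph ?C G"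
    unfolding component_of_def by (rule subgraph_induced_subgraph[OF G WV])
  \<comment> \<open>Every vertex of a path from \<open>v\<close> is itself reachable from
    \<open>v\<close>, so the path stays in the induced subgraph.\<close>
  have fwd: "(v, u) \<in> ?Q\<^sup>*" if "(v, u) \<in> ?R\<^sup>*" for u
    using that
  proof induction
    case (step y z)
    have "(v, z) \<in> ?R\<^sup>*" using step by (meson rtrancl.rtrancl_into_rtrancl)
    hence "(y, z) \<in> ?Q" using step by (auto simp: component_of_def)
    thus ?case using step.IH by (rule rtrancl_into_rtrancl[rotated])
  qed simp
  have symQ: "sym (?Q\<^sup>*)"
    by (intro sym_rtrancl) (auto simp: sym_def insert_commute)
  have conn: "connected_graph ?C"
    unfolding connected_graph_def
  proof (intro conjI ballI)
    show "verts ?C \<noteq> {}" by (auto simp: component_of_def)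
    fix u w assume "u \<in> verts ?C" "w \<in> verts ?C"
    hence "(v, u) \<in> ?Q\<^sup>*" "(v, w) \<in> ?Q\<^sup>*" using fwd by (auto simp: component_of_def)
    thus "(u, w) \<in> ?Q\<^sup>*" using symQ by (meson rtrancl_trans symD)
  qed
  \<comment> \<open>Maximality: a connected \<open>D\<close> that contains the component contains
    \<open>v\<close>, so all its vertices are reachable from \<open>v\<close>, and its edges then
    survive in the induced subgraph.\<close>
  have "D = ?C" if D: "subgraph D G" "connected_graph D" "subgraph ?C D" for D
  proof -
    have vD: "v \<in> verts D" using D(3) by (auto simp: subgraph_def component_of_def)
    have "{(x, y). {x, y} \<in> edges D}\<^sup>* \<subseteq> ?R\<^sup>*"
      using D(1) by (intro rtrancl_mono) (auto simp: subgraph_def)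
    hence V: "verts D \<subseteq> ?W"
      using D(2) vD by (auto simp: connected_graph_def)
    hence E: "edges D \<subseteq> edges ?C"
      using D(1) by (fastforce simp: subgraph_def simple_graph_def component_of_def)
    show ?thesis
      using V E D(3) by (intro ugraph.expand) (auto simp: subgraph_def component_of_def)
  qed
  thus ?thesis using sub conn by (auto simp: connected_component_def)
qed

text \<open>Walks are counted in the subgraph \<open>K\<close> of minimum degree at least 3, while
  the component is taken in \<open>H\<close>. Since edges of \<open>K\<close> are edges of
  \<open>H\<close>, all endpoints lie in the component of \<open>v\<close> in \<open>H\<close>, and
  they are pairwise distinct by injectivity of \<open>hd\<close>.\<close>

lemma large_component:
  assumes H: "simple_graph H" and avg: "average_degree H \<ge> 4"
    and no_cycle: "\<And>c. is_cycle H c \<Longrightarrow> 2 * r < length c"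
  obtains C where "connected_component C H" "2 ^ r \<le> card (verts C)"
proof -
  obtain W where W: "W \<subseteq> verts H" "W \<noteq> {}"
    and deg: "\<And>v. v \<in> W \<Longrightarrow> degree (induced_subgraph H W) v \<ge> 3"
    using min_degree_3_subgraph[OF H avg] by blast
  obtain v where v: "v \<in> W" using W by blast
  define K where "K = induced_subgraph H W"
  have K: "simple_graph K" "edges K \<subseteq> edges H"
    using subgraph_induced_subgraph[OF H W(1)] by (auto simp: K_def subgraph_def)
  have "2 * r < length c" if "is_cycle K c" for c
    using that K(2) by (intro no_cycle) (auto simp: is_cycle_def)
  hence inj: "inj_on hd (nb_walks K v r)" by (rule inj_on_hd_nb_walks[OF K(1)])
  let ?C = "component_of H v"
  have C: "connected_component ?C H"
    using component_of_connected_component[OF H] v W by blast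
  have "(v, hd xs) \<in> {(x, y). {x, y} \<in> edges H}\<^sup>*" if "xs \<in> nb_walks K v r" for xs
    using that
  proof (induction r arbitrary: xs)
    case (Suc r)
    then obtain x ys where xs: "xs = x # ys" "ys \<in> nb_walks K v r" "{x, hd ys} \<in> edges K" by auto
    hence "(hd ys, x) \<in> {(x, y). {x, y} \<in> edges H}" using K(2) by (auto simp: insert_commute)
    thus ?case using Suc.IH[OF xs(2)] xs(1) by (auto intro: rtrancl_into_rtrancl)
  qed simp
  hence "hd ` nb_walks K v r \<subseteq> verts ?C" by (auto simp: component_of_def)
  moreover have "finite (verts ?C)"
    using C by (auto simp: connected_component_def subgraph_def simple_graph_def)
  ultimately have "card (nb_walks K v r) \<le> card (verts ?C)"
    using inj by (metis card_image card_mono)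
  moreover have "2 ^ r \<le> card (nb_walks K v r)"
    using K(1) v deg by (intro card_nb_walks) (auto simp: K_def)
  ultimately show ?thesis using that[OF C] by linarith
qed

section \<open>Edge separators and expansion\<close>

lemma sep_E_attained:
  assumes G: "simple_graph G" and t: "card (verts G) \<ge> 2"
  obtains F where "edge_separator G F" "card F = sep_E G"
proof -
  have fin: "finite (verts G)" using G by (simp add: simple_graph_def)
  \<comment> \<open>The set of all edges separates any partition, so a split into halves suffices.
    The larger half, of size \<open>t/2\<close> rounded up, is at most \<open>2t/3\<close> for every
    \<open>t\<close> \<ge> 2 but not for \<open>t = 1\<close>.\<close>
  obtain A where A: "A \<subseteq> verts G" "card A = card (verts G) div 2"
    using obtain_subset_with_card_n[of "card (verts G) div 2" "verts G"] by auto
  have "card (verts G - A) = card (verts G) - card (verts G) div 2"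
    using A fin by (simp add: card_Diff_subset finite_subset)
  moreover have "3 * (card (verts G) - card (verts G) div 2) \<le> 2 * card (verts G)"
    using t by linarith
  moreover have "3 * (card (verts G) div 2) \<le> 2 * card (verts G)" by linarith
  ultimately have
    "real (card A) \<le> 2/3 * real (card (verts G))"
    "real (card (verts G - A)) \<le> 2/3 * real (card (verts G))"
    using A by linarith+
  hence "edge_separator G (edges G)"
    using A unfolding edge_separator_def
    by (intro conjI exI[of _ A] exI[of _ "verts G - A"]) auto
  hence "\<exists>m F. edge_separator G F \<and> card F = m" by blast
  hence "\<exists>F. edge_separator G F \<and> card F = sep_E G"
    unfolding sep_E_def by (rule LeastI_ex)
  thus ?thesis using that by blast
qed

text \<open>Let \<open>S\<close> be the smaller part of an optimal separation. The other part has at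
  most \<open>2t/3\<close> vertices, so \<open>S\<close> has at least \<open>t/3\<close>. Its
  boundary lies in the separator, hence has at most \<open>\<beta> * t / 3\<close> edges, which is
  at most \<open>\<beta> * card S\<close>.\<close>

lemma edge_expansion_from_separator:
  assumes G: "simple_graph G" and t: "card (verts G) \<ge> 2"
    and sep: "real (sep_E G) \<le> \<beta> * real (card (verts G)) / 3" and \<beta>: "\<beta> \<ge> 0"
  shows "edge_expansion_at_most G \<beta>"
proof -
  let ?t = "real (card (verts G))"
  obtain F where F: "edge_separator G F" "card F = sep_E G"
    using sep_E_attained[OF G t] .
  obtain A B where V: "verts G = A \<union> B" "A \<inter> B = {}"
    and AB: "real (card A) \<le> 2/3 * ?t" "real (card B) \<le> 2/3 * ?t"
    and no: "\<forall>a\<in>A. \<forall>b\<in>B. {a, b} \<notin> edges G - F" and FE: "F \<subseteq> edges G"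
    using F(1) unfolding edge_separator_def by blast
  have fin: "finite A" "finite B" using V(1) G by (auto simp: simple_graph_def)
  have tAB: "?t = real (card A) + real (card B)"
    using V fin by (simp add: card_Un_disjoint)
  have half: ?thesis
    if S: "verts G = S \<union> T" "real (card S) \<le> ?t / 2" "real (card S) \<ge> ?t / 3"
      and no': "\<forall>a\<in>S. \<forall>b\<in>T. {a, b} \<notin> edges G - F" for S T
    unfolding edge_expansion_at_most_def
  proof (intro exI[of _ S] conjI)
    show "S \<subseteq> verts G" "real (card S) \<le> ?t / 2" using S by auto
    show "S \<noteq> {}" using S(3) t by auto
    have "edge_boundary G S \<subseteq> F"
    proof
      fix e assume "e \<in> edge_boundary G S"
      hence e: "e \<in> edges G" "card (e \<inter> S) = 1" by (auto simp: edge_boundary_def)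
      have e2: "card e = 2" "e \<subseteq> verts G" using G e by (auto simp: simple_graph_def)
      obtain a where a: "e \<inter> S = {a}" using e(2) by (auto simp: card_1_singleton_iff)
      hence "a \<in> e" by blast
      then obtain b where b: "e = {a, b}" "b \<noteq> a"
        using e2(1) unfolding card_2_iff by (metis insert_commute insertE singletonD)
      have "b \<notin> S" using a b by auto
      hence "b \<in> T" using S(1) e2 b by auto
      thus "e \<in> F" using no' a b e(1) by blast
    qed
    moreover have "finite F" using FE simple_graph_finite_edges[OF G] finite_subset by blast
    ultimately have "real (card (edge_boundary G S)) \<le> real (sep_E G)"
      using F(2) card_mono by fastforce
    also have "\<dots> \<le> \<beta> * (?t / 3)" using sep by simp
    also have "\<dots> \<le> \<beta> * real (card S)" using S(3) \<beta> by (rule mult_left_mono)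
    finally show "real (card (edge_boundary G S)) \<le> \<beta> * real (card S)" .
  qed
  show ?thesis
  proof (cases "card A \<le> card B")
    case True
    thus ?thesis using tAB AB V(1) no by (intro half[of A B]) auto
  next
    case False
    moreover have "\<forall>b\<in>B. \<forall>a\<in>A. {b, a} \<notin> edges G - F" using no by (metis insert_commute)
    ultimately show ?thesis using tAB AB V(1) by (intro half[of B A]) auto
  qed
qed

section \<open>Numerical estimates and conclusion\<close>

lemma two_powr_ge_square:
  fixes x :: real
  assumes "x \<ge> 0"
  shows "x\<^sup>2 / 8 \<le> 2 powr x"
proof -
  \<comment> \<open>With \<open>ln 2\<close> \<ge> 1/2, the quadratic term of the exponential series
    alone gives \<open>(x/2)^2 / 2\<close>.\<close>
  have "ln 2 \<ge> (1/2 :: real)" using ln_le_minus_one[of "1/2 :: real"] by (simp add: ln_div)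
  hence y: "x / 2 \<le> x * ln 2" using assms mult_left_mono[of "1/2" "ln 2 :: real" x] by simp
  hence "(x / 2)\<^sup>2 \<le> (x * ln 2)\<^sup>2" using assms by (intro power_mono) auto
  hence "x\<^sup>2 / 8 \<le> (x * ln 2)\<^sup>2 / 2" by (simp add: power2_eq_square)
  also have "\<dots> \<le> exp (x * ln 2)"
    using exp_lower_Taylor_quadratic[of "x * ln 2"] assms y by linarith
  finally show ?thesis by (simp add: powr_def)
qed

theorem corollary2p3:
  fixes G :: "'a ugraph" and n :: nat and k :: real
  assumes "n > 0"
    and "2 \<le> k" and "k \<le> 1/648 * log 2 (log 2 (real n))"
    and "simple_graph G" and "card (verts G) = n"
    and "average_degree G \<ge> k" and "real (max_degree G) \<le> 6 * k"
    and "ereal_of_enat (girth G) \<ge> ereal (log 2 (real n) / (6 * k)^2)"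
    and "\<And>(H :: 'a ugraph) (t :: nat).
           \<lbrakk>subgraph H G; card (verts H) = t; real t \<ge> log 2 (real n) / (6 * k)^2\<rbrakk> \<Longrightarrow>
           sep_V H \<le> sep_E H \<and>
           real (sep_E H) \<le> real t / log 2 (real t) * (log 2 (log 2 (real t)))^2"
  shows "\<forall>H. subgraph H G \<and> average_degree H \<ge> 4 \<longrightarrow>
           (\<exists>C. connected_component C H \<and>
              edge_expansion_at_most C
                (1 / log 2 (real n) * (15 * k * log 2 (log 2 (real n)))^2))"
proof (intro allI impI, elim conjE)
  fix H assume HG: "subgraph H G" and avg: "average_degree H \<ge> 4"
  define L where "L = log 2 (real n)"
  define l where "l = log 2 L"
  define g where "g = L / (6 * k)^2"
  have k: "2 \<le> k" "648 * k \<le> l" using assms(2,3) by (auto simp: l_def L_def)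
  have "L \<ge> 0" using assms(1) by (simp add: L_def)
  \<comment> \<open>The logarithm of 0 is 0 by convention, which would contradict \<open>l\<close>
    \<ge> \<open>648 * k\<close>.\<close>
  moreover have "L \<noteq> 0" using k by (auto simp: l_def log_def)
  ultimately have L: "L > 0" by simp
  \<comment> \<open>Since \<open>648 = 108 * 6\<close> and \<open>108^2 = 11664\<close>, comparing
    \<open>(648 * k)^2\<close> with \<open>8 * L\<close> gives \<open>g\<close> \<ge> 11664 / 8 =
    1458.\<close>
  have "(648 * k)\<^sup>2 \<le> l\<^sup>2" using k by (intro power_mono) auto
  also have "l\<^sup>2 / 8 \<le> 2 powr l" using k by (intro two_powr_ge_square) simp
  hence "l\<^sup>2 \<le> 8 * L" using L by (simp add: l_def)
  finally have "11664 * (6 * k)\<^sup>2 \<le> 8 * L" by (simp add: power_mult_distrib)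
  hence g: "g \<ge> 1458" using k by (simp add: g_def pos_le_divide_eq)
  \<comment> \<open>The largest integer strictly below \<open>g / 2\<close>: strictness makes
    \<open>2 * r\<close> smaller than the length of every cycle.\<close>
  define r where "r = nat (\<lceil>g / 2\<rceil> - 1)"
  have "real r = of_int (\<lceil>g / 2\<rceil> - 1)" using g by (simp add: r_def)
  hence r: "2 * real r < g" "g / 2 - 1 \<le> real r" by linarith+
  have H: "simple_graph H" using HG by (simp add: subgraph_def)
  have "2 * r < length c" if c: "is_cycle H c" for c
  proof -
    have "is_cycle G c" using c HG by (auto simp: is_cycle_def subgraph_def)
    hence "girth G \<le> enat (length c)" unfolding girth_def by (intro Inf_lower) auto
    hence "ereal_of_enat (girth G) \<le> ereal_of_enat (enat (length c))"
      by (simp only: ereal_of_enat_le_iff)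
    hence "ereal_of_enat (girth G) \<le> ereal (real (length c))"
      by (simp only: ereal_of_enat_simps)
    with assms(8) have "ereal g \<le> ereal (real (length c))"
      unfolding g_def L_def by (rule order_trans)
    thus ?thesis using r by simp
  qed
  then obtain C where C: "connected_component C H" "2 ^ r \<le> card (verts C)"
    using large_component[OF H avg] by blast
  define t where "t = card (verts C)"
  have CG: "subgraph C G"
    using C(1) HG subgraph_trans by (auto simp: connected_component_def)
  have "verts C \<subseteq> verts G" "finite (verts G)"
    using CG assms(4) by (auto simp: subgraph_def simple_graph_def)
  hence tn: "t \<le> n" using assms(5) card_mono by (force simp: t_def)
  \<comment> \<open>The rounding loss is absorbed because \<open>12/25 * g\<close> \<le>
    \<open>g/2 - 1\<close> once \<open>g\<close> \<ge> 50. The factor 12/25 is the one that produces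
    the final constant: \<open>3 * 36 * 25/12 = 225 = 15^2\<close>.\<close>
  have "2 powr (12/25 * g) \<le> 2 powr real r" using r g by (intro powr_mono) linarith+
  also have "\<dots> = real (2 ^ r)" by (simp add: powr_realpow)
  also have "\<dots> \<le> real t" using C(2) by (simp only: t_def of_nat_le_iff)
  finally have t: "2 powr (12/25 * g) \<le> real t" .
  have t0: "real t > 0" using t by (rule less_le_trans[rotated]) simp
  have logt: "12/25 * g \<le> log 2 (real t)" using t t0 by (subst le_log_iff) auto
  \<comment> \<open>Hypothesis (iii) is only available for subgraphs with at least \<open>g\<close>
    vertices; the exponential lower bound on \<open>t\<close> ensures this.\<close>
  have "g * 1458 \<le> g * g" using g by (intro mult_left_mono) auto
  hence "g \<le> (12/25 * g)\<^sup>2 / 8" using g by (simp add: power2_eq_square)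
  also have "\<dots> \<le> 2 powr (12/25 * g)" using g by (intro two_powr_ge_square) simp
  finally have gt: "g \<le> real t" using t by simp
  \<comment> \<open>The separator bound needs \<open>log t\<close> from both sides: \<open>t\<close>
    \<le> \<open>n\<close> bounds the iterated logarithm by \<open>l\<close>, and the lower bound in
    terms of \<open>g\<close> controls the denominator. Squaring is monotone here because
    \<open>log t\<close> \<ge> 1.\<close>
  have "log 2 (real t) \<le> L" using tn t0 by (simp add: L_def)
  hence "log 2 (log 2 (real t)) \<le> l" using logt g by (simp add: l_def)
  moreover have "0 \<le> log 2 (log 2 (real t))" using logt g by simp
  ultimately have ll: "(log 2 (log 2 (real t)))\<^sup>2 \<le> l\<^sup>2" by (intro power_mono)
  have log_pos: "0 < log 2 (real t)" using logt g by linarith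
  let ?\<beta> = "1 / L * (15 * k * l)\<^sup>2"
  have "real (sep_E C) \<le> real t / log 2 (real t) * (log 2 (log 2 (real t)))\<^sup>2"
    using assms(9)[OF CG t_def[symmetric]] gt by (simp add: g_def L_def)
  also have "\<dots> \<le> real t / (12/25 * g) * l\<^sup>2"
    using logt g t0 log_pos by (intro mult_mono ll divide_left_mono mult_pos_pos) auto
  also have "\<dots> = ?\<beta> * real t / 3"
    using L k by (simp add: g_def power2_eq_square field_simps)
  finally have "real (sep_E C) \<le> ?\<beta> * real (card (verts C)) / 3" by (simp add: t_def)
  moreover have "card (verts C) \<ge> 2" using gt g by (simp add: t_def)
  moreover have "simple_graph C" using CG by (simp add: subgraph_def)
  ultimately have "edge_expansion_at_most C ?\<beta>"
    using L by (intro edge_expansion_from_separator) auto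
  thus "\<exists>C. connected_component C H \<and>
      edge_expansion_at_most C (1 / log 2 (real n) * (15 * k * log 2 (log 2 (real n)))^2)"
    using C(1) unfolding L_def l_def by blast
qed

end
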